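(* Let $m>1$ be a square-free integer. Then the abelian group $P_m$ has infinite rank.
   Context: Let $F_m=\mathbb{Q}[\sqrt{-m}]$. Let $\mathcal{S}_m$ be the multiplicative subgroup of $F_m\setminus\{0\}$ consisting of all nonzero elements $a+b\sqrt{-m}$ ($a,b\in\mathbb{Q}$) such that $a^2+mb^2$ is the square of a rational number, and let $G_m=\mathcal{S}_m/\mathbb{Q}^*$, an abelian group (written additively). A primitive triple is $(x,y,z)\in\mathbb{Z}\times\mathbb{Z}\times\mathbb{N}$ with $\gcd(x,y,z)=1$ and $x^2+my^2=z^2$; $[x,y,z]$ denotes the class of $x+y\sqrt{-m}$ in $G_m$. Every element of $G_m$ is represented by a primitive triple, unique up to $[x,y,z]\sim[-x,-y,z]$. $P_m\subseteq G_m$ is the subgroup generated by all $[1,Y,X]$ where $(X,Y)\in\mathbb{N}\times\mathbb{Z}$ satisfies Pell's equation $X^2-mY^2=1$. The rank of an abelian group is the maximal cardinality of a subset that is linearly independent over $\mathbb{Z}$. *)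

theory Defs
  imports Complex_Main "HOL-Algebra.Generated_Groups" "HOL-Algebra.FiniteProduct" "HOL-Library.Equipollence"
    "HOL-Computational_Algebra.Squarefree"
begin

definition quad :: "int \<Rightarrow> rat \<Rightarrow> rat \<Rightarrow> complex"
  where "quad m a b = of_rat a + of_rat b * csqrt (- of_int m)"

text \<open>The group \<open>\<S>\<^sub>m\<close>; its elements are taken as complex numbers.\<close>

definition S_group :: "int \<Rightarrow> complex monoid"
  where "S_group m =
    \<lparr> carrier = {quad m a b | a b. quad m a b \<noteq> 0 \<and> (\<exists>c. a\<^sup>2 + of_int m * b\<^sup>2 = c\<^sup>2)},
      monoid.mult = (*), one = 1 \<rparr>"

definition Qstar :: "complex set"
  where "Qstar = \<rat> - {0}"

text \<open>The quotient is in multiplicative notation, so the integer multiple \<open>n \<cdot> g\<close>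
  is the power \<open>g [^] n\<close>.\<close>

definition G_group :: "int \<Rightarrow> complex set monoid"
  where "G_group m = S_group m Mod Qstar"

text \<open>The class \<open>[x, y, z]\<close>: the third entry is determined by the first two and does not
  enter the formula.\<close>

definition triple_class :: "int \<Rightarrow> int \<Rightarrow> int \<Rightarrow> nat \<Rightarrow> complex set"
  where "triple_class m x y z = Qstar #>\<^bsub>S_group m\<^esub> quad m (of_int x) (of_int y)"

definition pell_classes :: "int \<Rightarrow> complex set set"
  where "pell_classes m =
    {triple_class m 1 Y X | (X :: nat) (Y :: int). (int X)\<^sup>2 - m * Y\<^sup>2 = 1}"

definition P_group :: "int \<Rightarrow> complex set monoid"
  where "P_group m = (G_group m)\<lparr>carrier := generate (G_group m) (pell_classes m)\<rparr>"

definition Z_independent :: "('a, 'b) monoid_scheme \<Rightarrow> 'a set \<Rightarrow> bool"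
  where "Z_independent K B \<longleftrightarrow> B \<subseteq> carrier K \<and>
    (\<forall>F n. finite F \<longrightarrow> F \<subseteq> B \<longrightarrow>
       finprod K (\<lambda>g. g [^]\<^bsub>K\<^esub> (n g :: int)) F = \<one>\<^bsub>K\<^esub> \<longrightarrow> (\<forall>g\<in>F. n g = 0))"

text \<open>An independent set of maximal cardinality; the cardinality of any such set is the rank.\<close>

definition attains_rank :: "('a, 'b) monoid_scheme \<Rightarrow> 'a set \<Rightarrow> bool"
  where "attains_rank K B \<longleftrightarrow> Z_independent K B \<and> (\<forall>T. Z_independent K T \<longrightarrow> T \<lesssim> B)"

definition infinite_rank :: "('a, 'b) monoid_scheme \<Rightarrow> bool"
  where "infinite_rank K \<longleftrightarrow> (\<exists>B. attains_rank K B \<and> infinite B)"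


lemma csqrt_sq: "csqrt (- of_int m) * csqrt (- of_int m) = - of_int m"
  by (metis power2_csqrt power2_eq_square)

lemma quad_mult:
  "quad m a b * quad m c d = quad m (a * c - of_int m * b * d) (a * d + b * c)"
proof -
  have "quad m a b * quad m c d = of_rat a * of_rat c
      + of_rat b * of_rat d * (csqrt (- of_int m) * csqrt (- of_int m))
      + (of_rat a * of_rat d + of_rat b * of_rat c) * csqrt (- of_int m)"
    unfolding quad_def by (simp only: algebra_simps)
  also have "\<dots> = quad m (a * c - of_int m * b * d) (a * d + b * c)"
    unfolding csqrt_sq quad_def by (simp add: of_rat_add of_rat_diff of_rat_mult algebra_simps)
  finally show ?thesis .
qed

lemma quad_rat: "quad m a 0 = of_rat a"
  by (simp add: quad_def)

lemma quad_in_S_group: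
  "quad m a b \<noteq> 0 \<Longrightarrow> a\<^sup>2 + of_int m * b\<^sup>2 = c\<^sup>2 \<Longrightarrow> quad m a b \<in> carrier (S_group m)"
  unfolding S_group_def by auto

lemma S_group_comm_group:
  assumes "m > 0"
  shows "comm_group (S_group m)"
proof (rule comm_groupI)
  fix x y assume "x \<in> carrier (S_group m)" "y \<in> carrier (S_group m)"
  then obtain a b r c d s where
    x: "x = quad m a b" "x \<noteq> 0" "a\<^sup>2 + of_int m * b\<^sup>2 = r\<^sup>2" and
    y: "y = quad m c d" "y \<noteq> 0" "c\<^sup>2 + of_int m * d\<^sup>2 = s\<^sup>2"
    by (auto simp: S_group_def)
  have "(a * c - of_int m * b * d)\<^sup>2 + of_int m * (a * d + b * c)\<^sup>2
      = (a\<^sup>2 + of_int m * b\<^sup>2) * (c\<^sup>2 + of_int m * d\<^sup>2)"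
    by (simp add: power2_eq_square algebra_simps)
  also have "\<dots> = (r * s)\<^sup>2"
    by (simp add: x y power_mult_distrib)
  finally have "quad m a b * quad m c d \<in> carrier (S_group m)"
    using x y quad_in_S_group unfolding quad_mult by (metis quad_mult mult_eq_0_iff)
  then show "x \<otimes>\<^bsub>S_group m\<^esub> y \<in> carrier (S_group m)"
    unfolding x(1) y(1) by (simp add: S_group_def)
next
  have "quad m 1 0 = 1" by (simp add: quad_rat)
  then show "\<one>\<^bsub>S_group m\<^esub> \<in> carrier (S_group m)"
    using quad_in_S_group[of m 1 0 1] by (simp add: S_group_def)
next
  fix x assume "x \<in> carrier (S_group m)"
  then obtain a b r where
    x: "x = quad m a b" "x \<noteq> 0" "a\<^sup>2 + of_int m * b\<^sup>2 = r\<^sup>2"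
    by (auto simp: S_group_def)
  have "a \<noteq> 0 \<or> b \<noteq> 0" using x by (auto simp: quad_rat)
  then have "a\<^sup>2 + of_int m * b\<^sup>2 > 0"
    using assms by (auto simp: add_pos_nonneg add_nonneg_pos)
  then have r: "r \<noteq> 0" using x by auto
  let ?y = "quad m (a / r\<^sup>2) (- b / r\<^sup>2)"
  have 1: "a * (a / r\<^sup>2) - of_int m * b * (- b / r\<^sup>2) = 1"
    using r x(3) by (simp add: field_simps power2_eq_square)
  have y: "?y * x = 1"
    using quad_mult[of m a b "a / r\<^sup>2" "- b / r\<^sup>2"] unfolding 1 x(1)
    by (simp add: mult.commute quad_rat)
  have "(a / r\<^sup>2)\<^sup>2 + of_int m * (- b / r\<^sup>2)\<^sup>2 = (a\<^sup>2 + of_int m * b\<^sup>2) / (r\<^sup>2)\<^sup>2"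
    by (simp add: power_divide add_divide_distrib)
  then have "(a / r\<^sup>2)\<^sup>2 + of_int m * (- b / r\<^sup>2)\<^sup>2 = (r / r\<^sup>2)\<^sup>2"
    unfolding x(3) by (simp add: power_divide)
  moreover have "?y \<noteq> 0" using y by auto
  ultimately have "?y \<in> carrier (S_group m)" by (intro quad_in_S_group)
  then show "\<exists>y\<in>carrier (S_group m). y \<otimes>\<^bsub>S_group m\<^esub> x = \<one>\<^bsub>S_group m\<^esub>"
    by (rule rev_bexI) (use y in \<open>simp add: S_group_def\<close>)
qed (auto simp: S_group_def)

lemma Qstar_subgroup:
  assumes "m > 0"
  shows "subgroup Qstar (S_group m)"
proof -
  interpret comm_group "S_group m" using assms by (rule S_group_comm_group)
  have sub: "Qstar \<subseteq> carrier (S_group m)"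
  proof
    fix q assume "q \<in> Qstar"
    then obtain a where "q = quad m a 0" "q \<noteq> 0"
      by (auto simp: Qstar_def quad_rat elim: Rats_cases)
    then show "q \<in> carrier (S_group m)"
      using quad_in_S_group[of m a 0 a] by simp
  qed
  show ?thesis
  proof (rule subgroupI[OF sub])
    show "Qstar \<noteq> {}" by (auto simp: Qstar_def intro: Rats_1)
  next
    fix q assume q: "q \<in> Qstar"
    then have "inverse q \<in> Qstar" by (auto simp: Qstar_def)
    moreover have "inverse q \<otimes>\<^bsub>S_group m\<^esub> q = \<one>\<^bsub>S_group m\<^esub>"
      using q by (auto simp: S_group_def Qstar_def)
    ultimately show "inv\<^bsub>S_group m\<^esub> q \<in> Qstar"
      using q sub inv_equality by (metis subsetD)
  next
    fix p q assume "p \<in> Qstar" "q \<in> Qstar"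
    then show "p \<otimes>\<^bsub>S_group m\<^esub> q \<in> Qstar" by (auto simp: S_group_def Qstar_def)
  qed
qed

lemma G_group_comm_group:
  assumes "m > 0"
  shows "comm_group (G_group m)"
  unfolding G_group_def
  using comm_group.abelian_FactGroup[OF S_group_comm_group Qstar_subgroup] assms by blast

lemma pell_classes_subset:
  assumes "m > 0"
  shows "pell_classes m \<subseteq> carrier (G_group m)"
proof
  fix g assume "g \<in> pell_classes m"
  then obtain X :: nat and Y where XY: "(int X)\<^sup>2 - m * Y\<^sup>2 = 1" and
    g: "g = Qstar #>\<^bsub>S_group m\<^esub> quad m 1 (of_int Y)"
    by (auto simp: pell_classes_def triple_class_def)
  have "1 + m * Y\<^sup>2 = (int X)\<^sup>2" using XY by simp
  then have "of_int (1 + m * Y\<^sup>2) = (of_int ((int X)\<^sup>2) :: rat)" by simp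
  then have sq: "1\<^sup>2 + of_int m * (of_int Y)\<^sup>2 = (of_nat X :: rat)\<^sup>2" by simp
  have "Re (quad m 1 (of_int Y)) = 1" using assms by (simp add: quad_def)
  then have "quad m 1 (of_int Y) \<noteq> 0" by auto
  then have "quad m 1 (of_int Y) \<in> carrier (S_group m)"
    using sq by (rule quad_in_S_group)
  then show "g \<in> carrier (G_group m)"
    unfolding g G_group_def FactGroup_def RCOSETS_def by auto
qed

lemma P_group_comm_group:
  assumes "m > 0"
  shows "comm_group (P_group m)"
proof -
  interpret comm_group "G_group m" using assms by (rule G_group_comm_group)
  have sub: "subgroup (generate (G_group m) (pell_classes m)) (G_group m)"
    using pell_classes_subset[OF assms] by (rule generate_is_subgroup)
  then interpret P: group "P_group m"
    unfolding P_group_def by (rule subgroup_imp_group)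
  show ?thesis
    using subgroup.subset[OF sub]
    by (intro P.group_comm_groupI) (auto simp: P_group_def intro!: m_comm)
qed

end

theory Submission
  imports Defs "HOL-Analysis.Kronecker_Approximation_Theorem" "HOL-Number_Theory.Cong"
begin

text \<open>
  Since \<open>P\<^sub>m\<close> is countable, every infinite \<open>\<int>\<close>-independent subset of it attains the rank, so it
  suffices to produce one.

  Pell's equation has a solution with \<open>Y \<noteq> 0\<close> (\<open>pell_solution_exists\<close>): \<open>\<surd>m\<close> has infinitely many
  good rational approximations, their norms \<open>h\<^sup>2 - m k\<^sup>2\<close> are bounded, and the quotient of two
  different approximations that share the norm and the residues modulo that norm is a unit. Squaring the unit
  \<open>X + Y \<surd>m\<close> repeatedly, that is \<open>(X, Y) \<mapsto> (2 X\<^sup>2 - 1, 2 X Y)\<close>, gives solutions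
  \<open>(X\<^sub>k, Y\<^sub>k)\<close> with odd, pairwise coprime \<open>X\<^sub>k > 1\<close> (\<open>coprime_pell_solutions_exist\<close>).

  The classes of \<open>\<alpha>\<^sub>k = 1 + Y\<^sub>k \<surd>-m\<close> are then independent. The number \<open>\<alpha>\<^sub>k\<close> has norm \<open>X\<^sub>k\<^sup>2\<close> and is
  not divisible by any prime number, so a prime \<open>p\<close> dividing \<open>X\<^sub>k\<close> splits and only one of the two
  prime ideals above \<open>p\<close> divides \<open>\<alpha>\<^sub>k\<close>, while neither divides the other \<open>\<alpha>\<^sub>j\<close>. Hence a product
  of powers of the \<open>\<alpha>\<^sub>j\<close> in which \<open>\<alpha>\<^sub>k\<close> has a nonzero exponent is not rational. No ideals are
  needed to carry this out (\<open>pell_ratios_independent\<close>): after replacing \<open>\<alpha>\<^sub>j\<close> by its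
  conjugate where the exponent is negative, the product is an integral element \<open>z\<close>. If \<open>z\<close> were
  rational, then \<open>\<bar>z\<bar>\<close>, being the product of the corresponding powers of the \<open>X\<^sub>j\<close>, would be
  divisible by \<open>X\<^sub>k\<close>; but there is a residue \<open>s\<close> with \<open>s\<^sup>2 \<equiv> -m\<close> modulo \<open>X\<^sub>k\<close> such that every factor
  becomes invertible modulo \<open>X\<^sub>k\<close> under \<open>\<surd>-m \<mapsto> s\<close>.

  The passage from the quotient group to complex numbers uses the homomorphism sending the class of
  \<open>z\<close> to \<open>z / cnj z\<close>, which is well defined because rational numbers are fixed by conjugation.
\<close>

section \<open>Solvability of Pell's equation\<close>

lemma squarefree_not_square:
  fixes m h k :: int
  assumes "m > 1" "squarefree m" "k \<noteq> 0"
  shows "h\<^sup>2 \<noteq> m * k\<^sup>2"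
proof
  assume eq: "h\<^sup>2 = m * k\<^sup>2"
  then have "k\<^sup>2 dvd h\<^sup>2" by simp
  then have "k dvd h" by simp
  then obtain r where r: "h = k * r" by (elim dvdE)
  then have "m = r\<^sup>2" using eq assms(3) by (simp add: power_mult_distrib)
  then have "r dvd 1" using assms(2) by (simp add: squarefree_def)
  then have "m = 1" using \<open>m = r\<^sup>2\<close> power2_abs[of r] by simp
  then show False using assms(1) by simp
qed

lemma sqrt_squarefree_irrational:
  fixes m :: int
  assumes "m > 1" "squarefree m"
  shows "sqrt (of_int m) \<notin> \<rat>"
proof
  assume "sqrt (of_int m) \<in> \<rat>"
  then obtain h k :: int where k: "k > 0" and eq: "sqrt (of_int m) = of_int h / of_int k"
    by (elim Rats_cases') auto
  have "of_int (h\<^sup>2) = (sqrt (of_int m) * of_int k)\<^sup>2" using k by (simp add: eq)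
  also have "\<dots> = of_int (m * k\<^sup>2)" using assms(1) by (simp add: power_mult_distrib)
  finally have "h\<^sup>2 = m * k\<^sup>2" by linarith
  then show False using squarefree_not_square[OF assms] k by auto
qed

text \<open>An approximation with error below \<open>1 / k\<^sup>2\<close> makes the factor \<open>h - k \<surd>m\<close> at most \<open>1 / k\<close>,
  while the conjugate factor is of size \<open>O(k)\<close>. Only boundedness independent of \<open>(h, k)\<close> matters
  below; \<open>m\<close> in place of \<open>\<surd>m\<close> keeps the bound an integer.\<close>

lemma norm_form_bound:
  fixes m h k :: int
  assumes m: "m > 1" and hk: "(h, k) \<in> approx_set (sqrt (of_int m))"
  shows "\<bar>h\<^sup>2 - m * k\<^sup>2\<bar> \<le> 2 * m + 1"
proof -
  let ?t = "sqrt (of_int m :: real)"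
  have k: "k > 0" and d: "\<bar>?t - of_int h / of_int k\<bar> < 1 / (of_int k)\<^sup>2"
    using hk by (auto simp: approx_set_def)
  have "\<bar>of_int k * ?t - of_int h\<bar> = of_int k * \<bar>?t - of_int h / of_int k\<bar>"
    using k by (simp add: abs_mult_pos' field_simps)
  also have "\<dots> \<le> of_int k * (1 / (of_int k)\<^sup>2)"
    using d k by (intro mult_left_mono) auto
  finally have small: "\<bar>of_int k * ?t - of_int h\<bar> \<le> 1 / of_int k"
    using k by (simp add: power2_eq_square)
  also have "\<dots> \<le> 1" using k by simp
  finally have "\<bar>of_int h + of_int k * ?t\<bar> \<le> 2 * (of_int k * ?t) + 1"
    using k m by (simp add: abs_le_iff) (smt (verit) mult_nonneg_nonneg of_int_0_le_iff real_sqrt_ge_zero)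
  also have "?t \<le> of_int m" using m by (intro real_le_lsqrt) (auto simp: power2_eq_square)
  then have "2 * (of_int k * ?t) + 1 \<le> of_int k * (2 * of_int m + 1)"
  proof -
    have "of_int k * ?t \<le> of_int k * of_int m" using k \<open>?t \<le> of_int m\<close> by (intro mult_left_mono) auto
    moreover have "(1 :: real) \<le> of_int k" using k by simp
    ultimately show ?thesis by (simp only: distrib_left mult.left_commute[of _ 2] mult_1_right)
  qed
  finally have big: "\<bar>of_int h + of_int k * ?t\<bar> \<le> of_int k * (2 * of_int m + 1)" .
  have "\<bar>(of_int h)\<^sup>2 - of_int m * (of_int k)\<^sup>2\<bar>
      = \<bar>of_int k * ?t - of_int h\<bar> * \<bar>of_int h + of_int k * ?t\<bar>"
    using m by (simp add: abs_mult[symmetric] algebra_simps power2_eq_square)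
  also have "\<dots> \<le> 1 / of_int k * (of_int k * (2 * of_int m + 1))"
    using small big k by (intro mult_mono) auto
  also have "\<dots> = 2 * of_int m + 1" using k by simp
  finally have "of_int \<bar>h\<^sup>2 - m * k\<^sup>2\<bar> \<le> (of_int (2 * m + 1) :: real)" by simp
  then show ?thesis unfolding of_int_le_iff .
qed

text \<open>The pigeonhole principle, applied to the infinitely many good approximations \<open>h / k\<close> of \<open>\<surd>m\<close>
  sorted by their norm and by the residues of \<open>h\<close> and \<open>k\<close> modulo that norm.\<close>

lemma pell_solution_exists:
  fixes m :: int
  assumes m: "m > 1" "squarefree m"
  obtains X Y :: int where "X\<^sup>2 - m * Y\<^sup>2 = 1" "Y \<noteq> 0"
proof -
  let ?A = "approx_set (sqrt (of_int m))"
  let ?N = "\<lambda>(h, k). h\<^sup>2 - m * k\<^sup>2"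
  let ?f = "\<lambda>p. (?N p, fst p mod ?N p, snd p mod ?N p)"
  let ?B = "{- (2 * m + 1)..2 * m + 1}"
  have range: "?f ` ?A \<subseteq> ?B \<times> ?B \<times> ?B"
  proof
    fix v assume "v \<in> ?f ` ?A"
    then obtain h k where hk: "(h, k) \<in> ?A" and v: "v = ?f (h, k)" by auto
    let ?n = "?N (h, k)"
    have n: "\<bar>?n\<bar> \<le> 2 * m + 1" using norm_form_bound[OF m(1) hk] by simp
    have "k \<noteq> 0" using hk by (auto simp: approx_set_def)
    then have "?n \<noteq> 0" using squarefree_not_square[OF m] by simp
    then have "\<bar>a mod ?n\<bar> \<le> 2 * m + 1" for a
      using n abs_mod_less[of ?n a] by linarith
    from this[of h] this[of k] n show "v \<in> ?B \<times> ?B \<times> ?B"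
      unfolding v by (auto simp: abs_le_iff)
  qed
  have "infinite ?A"
    using rational_iff_finite_approx_set sqrt_squarefree_irrational[OF m] by blast
  then have "\<not> inj_on ?f ?A"
    using range by (meson finite_SigmaI finite_atLeastAtMost_int finite_subset inj_on_finite)
  then obtain p q where pq: "p \<in> ?A" "q \<in> ?A" "p \<noteq> q" "?f p = ?f q"
    unfolding inj_on_def by blast
  obtain h k h' k' where p: "p = (h, k)" and q: "q = (h', k')" by fastforce
  define n where "n = h\<^sup>2 - m * k\<^sup>2"
  have k: "k > 0" "k' > 0" using pq by (auto simp: p q approx_set_def)
  then have n0: "n \<noteq> 0" using squarefree_not_square[OF m] by (simp add: n_def)
  have n': "h'\<^sup>2 - m * k'\<^sup>2 = n" and "h mod n = h' mod n" "k mod n = k' mod n"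
    using pq(4) by (auto simp: p q n_def)
  then have "n dvd h' - h" "n dvd k' - k"
    using mod_eq_dvd_iff[of h' n h] mod_eq_dvd_iff[of k' n k] by simp_all
  then obtain a b where h': "h' = h + n * a" and k': "k' = k + n * b"
    by (metis add.commute diff_add_cancel dvdE)
  \<comment> \<open>The quotient \<open>(h + k \<surd>m) / (h' + k' \<surd>m)\<close> of two elements of norm \<open>n\<close>, which is integral
    by the congruences modulo \<open>n\<close>.\<close>
  define X where "X = 1 + h * a - m * k * b"
  define Y where "Y = k * a - h * b"
  have nX: "n * X = h * h' - m * k * k'"
    by (simp add: X_def h' k' n_def power2_eq_square algebra_simps)
  have nY: "n * Y = k * h' - h * k'"
    by (simp add: Y_def h' k' algebra_simps)
  \<comment> \<open>Multiplicativity of the norm form.\<close>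
  have "n\<^sup>2 * (X\<^sup>2 - m * Y\<^sup>2) = (n * X)\<^sup>2 - m * (n * Y)\<^sup>2"
    by (simp add: power_mult_distrib algebra_simps)
  also have "\<dots> = (h\<^sup>2 - m * k\<^sup>2) * (h'\<^sup>2 - m * k'\<^sup>2)"
    unfolding nX nY by (simp add: power2_eq_square algebra_simps)
  also have "\<dots> = n\<^sup>2 * 1" unfolding n' n_def[symmetric] by (simp add: power2_eq_square)
  finally have "X\<^sup>2 - m * Y\<^sup>2 = 1" using n0 by simp
  moreover have "Y \<noteq> 0"
  proof
    \<comment> \<open>The two approximations would be proportional, hence equal, as they have the same norm.\<close>
    assume "Y = 0"
    then have hk: "k * h' = h * k'" using nY by simp
    have "n * k'\<^sup>2 = (h * k')\<^sup>2 - m * k\<^sup>2 * k'\<^sup>2"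
      by (simp add: n_def power_mult_distrib algebra_simps)
    also have "\<dots> = k\<^sup>2 * (h'\<^sup>2 - m * k'\<^sup>2)"
      by (simp add: hk[symmetric] power_mult_distrib algebra_simps)
    finally have "k'\<^sup>2 = k\<^sup>2" using n0 n' by simp
    then have "k' = k" using k by simp
    with hk k have "h' = h" by simp
    with \<open>k' = k\<close> show False using pq(3) by (simp add: p q)
  qed
  ultimately show thesis by (rule that)
qed

section \<open>Pairwise coprime solutions\<close>

text \<open>For a solution of Pell's equation \<open>(X + Y \<surd>m)\<^sup>2 = 2 X\<^sup>2 - 1 + 2 X Y \<surd>m\<close>, so this iterates squaring and its
  \<open>k\<close>-th entry is the \<open>2\<^sup>k\<close>-th power.\<close>

primrec pell_double :: "int \<times> int \<Rightarrow> nat \<Rightarrow> int \<times> int" where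
  "pell_double p 0 = p"
| "pell_double p (Suc k) = (case pell_double p k of (X, Y) \<Rightarrow> (2 * X\<^sup>2 - 1, 2 * X * Y))"

text \<open>Modulo \<open>X j\<close>, the map \<open>t \<mapsto> 2 t\<^sup>2 - 1\<close> sends \<open>X j \<equiv> 0\<close> to \<open>-1\<close> and then to the fixed point
  \<open>1\<close>, so no later entry of the sequence shares a factor with \<open>X j\<close>.\<close>

lemma coprime_pell_solutions_exist:
  fixes m :: int
  assumes m: "m > 1" "squarefree m"
  obtains X Y :: "nat \<Rightarrow> int" where
    "\<And>k. (X k)\<^sup>2 - m * (Y k)\<^sup>2 = 1" "\<And>k. odd (X k)" "\<And>k. X k > 1"
    "\<And>j k. j \<noteq> k \<Longrightarrow> coprime (X k) (X j)"
proof -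
  obtain x y where xy: "x\<^sup>2 - m * y\<^sup>2 = 1" "y \<noteq> 0" using pell_solution_exists[OF m] .
  \<comment> \<open>Starting from the first square makes every \<open>X k\<close> odd, also if \<open>x\<close> is even, and positive.\<close>
  define p where "p = (2 * x\<^sup>2 - 1, 2 * x * y)"
  define X where "X k = fst (pell_double p k)" for k
  define Y where "Y k = snd (pell_double p k)" for k
  have X_Suc: "X (Suc k) = 2 * (X k)\<^sup>2 - 1" and Y_Suc: "Y (Suc k) = 2 * X k * Y k" for k
    by (simp_all add: X_def Y_def split: prod.splits)
  have double: "(2 * u\<^sup>2 - 1)\<^sup>2 - m * (2 * u * v)\<^sup>2 = 1" if "u\<^sup>2 - m * v\<^sup>2 = 1" for u v
  proof -
    have "m * (2 * u * v)\<^sup>2 = 4 * u\<^sup>2 * (m * v\<^sup>2)" by (simp add: power2_eq_square algebra_simps)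
    also have "m * v\<^sup>2 = u\<^sup>2 - 1" using that by simp
    finally show ?thesis by (simp add: power2_eq_square algebra_simps)
  qed
  have pell: "(X k)\<^sup>2 - m * (Y k)\<^sup>2 = 1" for k
  proof (induction k)
    case 0
    then show ?case using double[OF xy(1)] by (simp add: X_def Y_def p_def)
  next
    case (Suc k)
    then show ?case using double by (simp add: X_Suc Y_Suc)
  qed
  have odd: "odd (X k)" for k
    by (cases k) (simp_all add: X_Suc, simp add: X_def p_def)
  have gt: "X k > 1" for k
  proof (induction k)
    case 0
    have "m * y\<^sup>2 > 0" using m xy(2) by simp
    then have "x\<^sup>2 > 1" using xy(1) by linarith
    then show ?case by (simp add: X_def p_def)
  next
    case (Suc k)
    then have "(X k)\<^sup>2 > 1" by (simp add: power2_eq_square less_1_mult)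
    then show ?case by (simp add: X_Suc)
  qed
  have sq: "[(X (Suc (j + i)))\<^sup>2 = 1] (mod X j)" for i j
  proof (induction i)
    case 0
    have "X (Suc j) ^ 2 - 1 = X j * (4 * X j * ((X j)\<^sup>2 - 1))"
      by (simp add: X_Suc power2_eq_square algebra_simps)
    then show ?case by (simp add: cong_iff_dvd_diff)
  next
    case (Suc i)
    have "X (Suc (j + Suc i)) ^ 2 - 1
        = ((X (Suc (j + i)))\<^sup>2 - 1) * (4 * (X (Suc (j + i)))\<^sup>2)"
    proof -
      have "X (Suc (j + Suc i)) = 2 * (X (Suc (j + i)))\<^sup>2 - 1" using X_Suc[of "Suc (j + i)"] by simp
      then show ?thesis by (simp add: power2_eq_square ring_distribs)
    qed
    with Suc show ?case by (metis cong_iff_dvd_diff dvd_mult2)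
  qed
  have less: "coprime (X k) (X j)" if "j < k" for j k
  proof -
    obtain i where "k = Suc (j + i)" using \<open>j < k\<close> less_imp_Suc_add by blast
    then have "coprime ((X k)\<^sup>2) (X j)" using sq cong_imp_coprime cong_sym coprime_1_left by metis
    then show ?thesis by simp
  qed
  have "coprime (X k) (X j)" if "j \<noteq> k" for j k
    using less that by (metis coprime_commute nat_neq_iff)
  with pell odd gt show thesis using that by blast
qed

section \<open>Multiplicative independence\<close>

lemma complex_of_rat_eq: "complex_of_rat q = of_real (of_rat q)"
  by (cases q) (simp add: of_rat_rat)

lemma quad_eq:
  assumes "m > 0"
  shows "quad m a b = Complex (of_rat a) (of_rat b * sqrt (of_int m))"
  using assms by (simp add: quad_def complex_of_rat_eq complex_eq_iff)

lemma cnj_quad: "m > 0 \<Longrightarrow> cnj (quad m a b) = quad m a (- b)"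
  by (simp add: quad_eq of_rat_minus complex_eq_iff)

text \<open>If \<open>s\<^sup>2 \<equiv> -m\<close> modulo \<open>N\<close>, then \<open>a + b \<surd>-m \<mapsto> a + s b\<close> is a ring homomorphism from
  \<open>\<int>[\<surd>-m]\<close> to \<open>\<int>/N\<close>; this set is the preimage of the units, and therefore closed under
  products.\<close>

definition unit_residues :: "int \<Rightarrow> int \<Rightarrow> int \<Rightarrow> complex set" where
  "unit_residues m s N = {quad m (of_int a) (of_int b) | a b. coprime (a + s * b) N}"

lemma unit_residues_prod_power:
  assumes s: "N dvd s\<^sup>2 + m" and fin: "finite K" and f: "\<And>k. k \<in> K \<Longrightarrow> f k \<in> unit_residues m s N"
  shows "(\<Prod>k\<in>K. f k ^ e k) \<in> unit_residues m s N"
proof -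
  have one: "1 \<in> unit_residues m s N"
    unfolding unit_residues_def
    by (rule CollectI, rule exI[of _ 1], rule exI[of _ 0]) (simp add: quad_rat)
  have mult: "u * v \<in> unit_residues m s N"
    if u: "u \<in> unit_residues m s N" and v: "v \<in> unit_residues m s N" for u v
  proof -
    obtain a b c d where ab: "u = quad m (of_int a) (of_int b)" "coprime (a + s * b) N"
      and cd: "v = quad m (of_int c) (of_int d)" "coprime (c + s * d) N"
      using u v by (auto simp: unit_residues_def)
    define x where "x = a * c - m * b * d"
    define y where "y = a * d + b * c"
    have "(a + s * b) * (c + s * d) - (x + s * y) = (s\<^sup>2 + m) * (b * d)"
      by (simp add: x_def y_def power2_eq_square algebra_simps)
    then have "[(a + s * b) * (c + s * d) = x + s * y] (mod N)"
      using s by (simp add: cong_iff_dvd_diff)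
    moreover have "coprime ((a + s * b) * (c + s * d)) N" using ab cd by simp
    ultimately have "coprime (x + s * y) N" by (rule cong_imp_coprime)
    moreover have "u * v = quad m (of_int x) (of_int y)"
      by (simp add: ab cd quad_mult x_def y_def)
    ultimately show ?thesis unfolding unit_residues_def by blast
  qed
  have "u ^ n \<in> unit_residues m s N" if "u \<in> unit_residues m s N" for u n
    by (induction n) (use that one mult in auto)
  with fin f show ?thesis
    by (induction K rule: finite_induct) (use one mult in auto)
qed

text \<open>The ratio of \<open>\<alpha> = 1 + Y \<surd>-m\<close> to its conjugate depends only on the class of \<open>\<alpha>\<close>, and inverting
  it amounts to conjugating \<open>\<alpha>\<close>. So a relation between the ratios, with exponents of either sign,
  says that a product of nonnegative powers of the \<open>\<alpha>\<close> and their conjugates is real. The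
  integer so obtained is divisible by \<open>X j\<close> because of its absolute value, and invertible modulo
  \<open>X j\<close> because its factors are.\<close>

lemma pell_ratios_independent:
  fixes m :: int and X Y :: "nat \<Rightarrow> int" and n :: "nat \<Rightarrow> int"
  assumes m: "m > 1"
    and pell: "\<And>k. (X k)\<^sup>2 - m * (Y k)\<^sup>2 = 1" and odd: "\<And>k. odd (X k)" and gt: "\<And>k. X k > 1"
    and cop: "\<And>j k. j \<noteq> k \<Longrightarrow> coprime (X k) (X j)"
    and K: "finite K" "j \<in> K"
    and prod: "(\<Prod>k\<in>K. (quad m 1 (of_int (Y k)) / cnj (quad m 1 (of_int (Y k)))) powi n k) = 1"
  shows "n j = 0"
proof (rule ccontr)
  assume nj: "n j \<noteq> 0"
  define \<epsilon> where "\<epsilon> k = (if n k \<ge> 0 then 1 else - 1 :: int)" for k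
  define e where "e k = nat \<bar>n k\<bar>" for k
  define \<beta> where "\<beta> k = quad m (of_int 1) (of_int (\<epsilon> k * Y k))" for k
  define z where "z = (\<Prod>k\<in>K. \<beta> k ^ e k)"
  have mpos: "m > 0" using m by simp
  have \<epsilon>2: "\<epsilon> k * \<epsilon> k = 1" for k by (simp add: \<epsilon>_def)
  have norm: "cmod (\<beta> k) = of_int (X k)" for k
  proof -
    have "1 + m * (Y k)\<^sup>2 = (X k)\<^sup>2" using pell[of k] by simp
    then have eq: "1 + of_int m * (of_int (Y k))\<^sup>2 = (of_int (X k) :: real)\<^sup>2"
      by (metis of_int_1 of_int_add of_int_mult of_int_power)
    have "cmod (\<beta> k) = sqrt (1 + of_int m * (of_int (Y k))\<^sup>2)"
      using mpos \<epsilon>2[of k]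
      by (simp add: \<beta>_def quad_eq complex_norm power_mult_distrib \<epsilon>_def mult.commute of_rat_minus)
    also have "\<dots> = of_int (X k)" unfolding eq using gt[of k] by simp
    finally show ?thesis .
  qed
  have \<beta>0: "\<beta> k \<noteq> 0" for k using norm[of k] gt[of k] by auto
  have z0: "z \<noteq> 0" using \<beta>0 K by (simp add: z_def)
  have ratio: "(quad m 1 (of_int (Y k)) / cnj (quad m 1 (of_int (Y k)))) powi n k
      = (\<beta> k / cnj (\<beta> k)) ^ e k" for k
  proof (cases "n k \<ge> 0")
    case True
    then show ?thesis by (simp add: \<beta>_def \<epsilon>_def e_def power_int_nonneg_exp)
  next
    case False
    then show ?thesis
      by (simp add: \<beta>_def \<epsilon>_def e_def power_int_def cnj_quad[OF mpos] of_rat_minus)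
  qed
  have "z / cnj z = (\<Prod>k\<in>K. (\<beta> k / cnj (\<beta> k)) ^ e k)"
    by (simp add: z_def prod_dividef power_divide)
  also have "\<dots> = 1" using prod by (simp add: ratio)
  finally have "z = cnj z" using z0 by (simp add: field_simps)
  then have real: "Im z = 0" by (simp add: complex_eq_iff)

  \<comment> \<open>A square root of \<open>-m\<close> modulo \<open>X j\<close>, because \<open>m Y\<^sup>2 \<equiv> -1\<close> there. Its sign is chosen such that
    \<open>\<surd>-m \<mapsto> s\<close> sends \<open>\<beta> j\<close> to \<open>2\<close>; the other choice would send it to \<open>0\<close>.\<close>
  define s where "s = - \<epsilon> j * m * Y j"
  have mY: "m * (Y k)\<^sup>2 = (X k)\<^sup>2 - 1" for k using pell[of k] by simp
  have s2: "s\<^sup>2 + m = m * (X j)\<^sup>2"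
  proof -
    have "s\<^sup>2 + m = (\<epsilon> j * \<epsilon> j) * m * (m * (Y j)\<^sup>2) + m"
      by (simp add: s_def power2_eq_square algebra_simps)
    then show ?thesis by (simp add: \<epsilon>2 mY algebra_simps)
  qed
  have "\<beta> k \<in> unit_residues m s (X j)" for k
  proof -
    have "coprime (1 + s * (\<epsilon> k * Y k)) (X j)"
    proof (cases "k = j")
      case True
      have "s * (\<epsilon> j * Y j) = - (\<epsilon> j * \<epsilon> j) * (m * (Y j)\<^sup>2)"
        by (simp add: s_def power2_eq_square algebra_simps)
      then have "2 - (1 + s * (\<epsilon> j * Y j)) = X j * X j"
        by (simp only: \<epsilon>2 mY) (simp add: power2_eq_square)
      then have "[2 = 1 + s * (\<epsilon> j * Y j)] (mod X j)" by (simp add: cong_iff_dvd_diff)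
      moreover have "coprime 2 (X j)" using odd by simp
      ultimately show ?thesis unfolding True by (rule cong_imp_coprime)
    next
      case False
      \<comment> \<open>The images of \<open>\<beta> k\<close> and of its conjugate multiply to the norm \<open>(X k)\<^sup>2\<close>, a unit.\<close>
      let ?c = "\<epsilon> k * Y k"
      have "(X k)\<^sup>2 - (1 + s * ?c) * (1 - s * ?c) = (X k)\<^sup>2 - 1 + s\<^sup>2 * (Y k)\<^sup>2 * (\<epsilon> k * \<epsilon> k)"
        by (simp add: power2_eq_square algebra_simps)
      also have "\<dots> = (s\<^sup>2 + m) * (Y k)\<^sup>2"
        by (simp add: \<epsilon>2 mY[symmetric] algebra_simps)
      also have "\<dots> = X j * (m * X j * (Y k)\<^sup>2)"
        unfolding s2 by (simp add: power2_eq_square)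
      finally have "[(X k)\<^sup>2 = (1 + s * ?c) * (1 - s * ?c)] (mod X j)"
        by (simp add: cong_iff_dvd_diff)
      moreover have "coprime ((X k)\<^sup>2) (X j)" using cop False by simp
      ultimately have "coprime ((1 + s * ?c) * (1 - s * ?c)) (X j)" by (rule cong_imp_coprime)
      then show ?thesis by simp
    qed
    then show ?thesis unfolding \<beta>_def unit_residues_def by blast
  qed
  then have "z \<in> unit_residues m s (X j)"
    unfolding z_def using s2 K(1) by (intro unit_residues_prod_power) auto
  then obtain A B where z: "z = quad m (of_int A) (of_int B)" and AB: "coprime (A + s * B) (X j)"
    by (auto simp: unit_residues_def)
  have "B = 0" using real mpos by (simp add: z quad_eq)
  then have A: "coprime A (X j)" and "z = of_int A" using AB by (simp_all add: z quad_rat)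
  then have "of_int \<bar>A\<bar> = cmod z" by simp
  also have "\<dots> = of_int (\<Prod>k\<in>K. X k ^ e k)"
    by (simp add: z_def prod_norm[symmetric] norm_power norm)
  finally have "\<bar>A\<bar> = (\<Prod>k\<in>K. X k ^ e k)" by linarith
  moreover have "X j ^ e j dvd (\<Prod>k\<in>K. X k ^ e k)" using K by (intro dvd_prodI) auto
  moreover have "X j dvd X j ^ e j" using nj by (intro dvd_power) (auto simp: e_def)
  ultimately have "X j dvd A" by (metis dvd_abs_iff dvd_trans)
  with A have "is_unit (X j)" by (meson coprime_common_divisor dvd_refl)
  then show False using gt[of j] by simp
qed

section \<open>A character of the quotient group\<close>

definition Cstar :: "complex monoid" where
  "Cstar = \<lparr>carrier = UNIV - {0}, monoid.mult = (*), one = 1\<rparr>"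

lemma Cstar_comm_group: "comm_group Cstar"
proof (rule comm_groupI)
  fix x assume "x \<in> carrier Cstar"
  then show "\<exists>y\<in>carrier Cstar. y \<otimes>\<^bsub>Cstar\<^esub> x = \<one>\<^bsub>Cstar\<^esub>"
    by (intro bexI[of _ "inverse x"]) (auto simp: Cstar_def)
qed (auto simp: Cstar_def)

lemma Cstar_int_pow:
  assumes "x \<noteq> 0"
  shows "x [^]\<^bsub>Cstar\<^esub> (n :: int) = x powi n"
proof -
  interpret comm_group Cstar by (rule Cstar_comm_group)
  have pow: "x [^]\<^bsub>Cstar\<^esub> k = x ^ k" for k :: nat
    by (induction k) (simp_all add: Cstar_def)
  have inv: "inv\<^bsub>Cstar\<^esub> y = inverse y" if "y \<noteq> 0" for y
    using that by (intro inv_equality) (auto simp: Cstar_def)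
  show ?thesis
    using assms by (simp add: int_pow_def2 pow inv power_int_def power_inverse)
qed

lemma hom_finprod_int_pow:
  assumes G: "comm_group G" and \<phi>: "\<phi> \<in> hom G Cstar" and F: "finite F" "F \<subseteq> carrier G"
  shows "\<phi> (finprod G (\<lambda>g. g [^]\<^bsub>G\<^esub> (n g :: int)) F) = (\<Prod>g\<in>F. \<phi> g powi n g)"
proof -
  interpret G: comm_group G by (rule G)
  interpret C: comm_group Cstar by (rule Cstar_comm_group)
  interpret group_hom G Cstar \<phi> using \<phi> by unfold_locales
  have pow: "\<phi> (g [^]\<^bsub>G\<^esub> k) = \<phi> g powi k" if "g \<in> carrier G" for g and k :: int
  proof -
    have "\<phi> g \<noteq> 0" using hom_closed[OF that] by (simp add: Cstar_def)
    then show ?thesis using that by (simp add: hom_int_pow Cstar_int_pow)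
  qed
  show ?thesis
    using F
  proof (induction F rule: finite_induct)
    case empty
    then show ?case using hom_one by (simp add: Cstar_def)
  next
    case (insert g F)
    have "finprod G (\<lambda>g. g [^]\<^bsub>G\<^esub> n g) F \<in> carrier G"
      using insert by (intro G.finprod_closed) auto
    then show ?case
      using insert by (simp add: G.finprod_insert Pi_iff subset_iff hom_mult pow) (simp add: Cstar_def)
  qed
qed

text \<open>Rational factors cancel in \<open>z / cnj z\<close>, so it is a function of the class of \<open>z\<close>. Through it a
  relation between classes becomes an equation between complex numbers.\<close>

lemma G_group_character:
  assumes "m > 0"
  obtains \<phi> where "\<phi> \<in> hom (G_group m) Cstar"
    "\<And>z. z \<in> carrier (S_group m) \<Longrightarrow> \<phi> (Qstar #>\<^bsub>S_group m\<^esub> z) = z / cnj z"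
proof -
  interpret S: comm_group "S_group m" using assms by (rule S_group_comm_group)
  have normal: "Qstar \<lhd> S_group m"
    using S.subgroup_imp_normal Qstar_subgroup[OF assms] by blast
  have hom: "(\<lambda>z. z / cnj z) \<in> hom (S_group m) Cstar"
    by (auto simp: hom_def S_group_def Cstar_def)
  show thesis
  proof (rule FactGroup_universal[OF hom normal])
    fix x y assume xy: "x \<in> carrier (S_group m)" "y \<in> carrier (S_group m)"
      "Qstar #>\<^bsub>S_group m\<^esub> x = Qstar #>\<^bsub>S_group m\<^esub> y"
    have "x \<in> Qstar #>\<^bsub>S_group m\<^esub> y"
      using xy S.rcos_self Qstar_subgroup[OF assms] by metis
    then obtain q where q: "q \<in> \<rat>" "q \<noteq> 0" "x = q * y"
      by (auto simp: r_coset_def Qstar_def S_group_def)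
    have "cnj q = q" using q(1) by (elim Rats_cases) (simp add: complex_of_rat_eq)
    with q show "x / cnj x = y / cnj y" by simp
  next
    fix g assume "g \<in> hom (S_group m Mod Qstar) Cstar"
      "\<And>x. x \<in> carrier (S_group m) \<Longrightarrow> g (Qstar #>\<^bsub>S_group m\<^esub> x) = x / cnj x"
    then show thesis by (intro that[of g]) (simp_all add: G_group_def)
  qed
qed

section \<open>The rank\<close>

lemma P_group_carrier_subset:
  assumes "m > 0"
  shows "carrier (P_group m) \<subseteq> carrier (G_group m)"
proof -
  interpret comm_group "G_group m" using assms by (rule G_group_comm_group)
  show ?thesis
    using generate_incl[OF pell_classes_subset[OF assms]] by (simp add: P_group_def)
qed

lemma countable_carrier_P_group:
  assumes "m > 0"
  shows "countable (carrier (P_group m))"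
proof -
  have "carrier (S_group m) \<subseteq> (\<lambda>(a, b). quad m a b) ` UNIV" by (auto simp: S_group_def)
  then have "countable (carrier (S_group m))" by (rule countable_subset) simp
  then have "countable (carrier (G_group m))" by (simp add: G_group_def carrier_FactGroup)
  with P_group_carrier_subset[OF assms] show ?thesis by (rule countable_subset)
qed

text \<open>In a countable group every independent set injects into any infinite one, so there is no need to
  extend the independent set to a maximal one.\<close>

lemma countable_infinite_independent_attains_rank:
  assumes "countable (carrier K)" "Z_independent K B" "infinite B"
  shows "attains_rank K B"
  unfolding attains_rank_def
proof (intro conjI allI impI)
  fix T assume "Z_independent K T"
  then have "countable T" using assms(1) countable_subset by (auto simp: Z_independent_def)
  then have "T \<lesssim> (UNIV :: nat set)" by (auto simp: lepoll_def countable_def)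
  also have "\<dots> \<lesssim> B" using assms(3) infinite_le_lepoll by blast
  finally show "T \<lesssim> B" .
qed (rule assms(2))

theorem proposition3:
  fixes m :: int
  assumes "m > 1" and "squarefree m"
  shows "infinite_rank (P_group m)"
proof -
  have m: "m > 0" using assms(1) by simp
  obtain X Y :: "nat \<Rightarrow> int" where
    pell: "\<And>k. (X k)\<^sup>2 - m * (Y k)\<^sup>2 = 1" and odd: "\<And>k. odd (X k)" and gt: "\<And>k. X k > 1"
    and cop: "\<And>j k. j \<noteq> k \<Longrightarrow> coprime (X k) (X j)"
    using coprime_pell_solutions_exist[OF assms] by blast
  define \<alpha> where "\<alpha> k = quad m 1 (of_int (Y k))" for k
  define c where "c k = triple_class m 1 (Y k) (nat (X k))" for k
  define B where "B = range c"
  obtain \<phi> where \<phi>: "\<phi> \<in> hom (G_group m) Cstar"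
    and \<phi>_coset: "\<And>z. z \<in> carrier (S_group m) \<Longrightarrow> \<phi> (Qstar #>\<^bsub>S_group m\<^esub> z) = z / cnj z"
    using G_group_character[OF m] by blast
  have \<phi>P: "\<phi> \<in> hom (P_group m) Cstar"
    using \<phi> P_group_carrier_subset[OF m] by (auto simp: hom_def P_group_def)
  have \<alpha>_S: "\<alpha> k \<in> carrier (S_group m)" for k
  proof -
    have "1 + m * (Y k)\<^sup>2 = (X k)\<^sup>2" using pell[of k] by simp
    then have "1\<^sup>2 + of_int m * (of_int (Y k))\<^sup>2 = (of_int (X k) :: rat)\<^sup>2"
      by (metis of_int_1 of_int_add of_int_mult of_int_power power_one)
    moreover have "quad m 1 (of_int (Y k)) \<noteq> 0" using m by (simp add: quad_eq complex_eq_iff)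
    ultimately show ?thesis unfolding \<alpha>_def by (intro quad_in_S_group)
  qed
  have \<phi>c: "\<phi> (c k) = \<alpha> k / cnj (\<alpha> k)" for k
    using \<phi>_coset[OF \<alpha>_S] by (simp add: c_def \<alpha>_def triple_class_def)
  have indep: "n j = 0" if "finite K" "j \<in> K" "(\<Prod>k\<in>K. \<phi> (c k) powi n k) = 1" for n K j
    using pell_ratios_independent[where X = X and Y = Y, OF assms(1) pell odd gt cop that(1,2)]
      that(3) by (simp add: \<phi>c \<alpha>_def)
  \<comment> \<open>If \<open>c j = c k\<close>, the exponents \<open>1\<close> and \<open>-1\<close> would give a nontrivial relation.\<close>
  have "inj c"
  proof (rule injI, rule ccontr)
    fix j k assume eq: "c j = c k" and "j \<noteq> k"
    have "\<phi> (c k) \<noteq> 0" using \<alpha>_S[of k] by (auto simp: \<phi>c S_group_def)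
    then have "(\<Prod>i\<in>{j, k}. \<phi> (c i) powi (if i = j then 1 else - 1)) = 1"
      using \<open>j \<noteq> k\<close> by (simp add: eq power_int_minus)
    from indep[OF _ _ this, of j] show False by simp
  qed
  have B_sub: "B \<subseteq> carrier (P_group m)"
  proof
    fix g assume "g \<in> B"
    then obtain k where g: "g = c k" by (auto simp: B_def)
    have "(int (nat (X k)))\<^sup>2 - m * (Y k)\<^sup>2 = 1" using pell[of k] gt[of k] by simp
    then have "g \<in> pell_classes m" unfolding pell_classes_def g c_def by blast
    then show "g \<in> carrier (P_group m)" by (simp add: P_group_def generate.incl)
  qed
  have "Z_independent (P_group m) B"
    unfolding Z_independent_def
  proof (intro conjI allI impI ballI)
    fix F and n :: "complex set \<Rightarrow> int" and g
    assume F: "finite F" "F \<subseteq> B"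
      and one: "finprod (P_group m) (\<lambda>g. g [^]\<^bsub>P_group m\<^esub> n g) F = \<one>\<^bsub>P_group m\<^esub>" and g: "g \<in> F"
    interpret P: comm_group "P_group m" by (rule P_group_comm_group[OF m])
    interpret C: comm_group Cstar by (rule Cstar_comm_group)
    obtain K where K: "finite K" "F = c ` K"
      using F finite_subset_image[of F c UNIV] by (auto simp: B_def)
    have inj: "inj_on c K" using \<open>inj c\<close> inj_on_subset by blast
    obtain j where j: "j \<in> K" "g = c j" using g K by blast
    have "(\<Prod>k\<in>K. \<phi> (c k) powi n (c k)) = (\<Prod>g\<in>F. \<phi> g powi n g)"
      unfolding K(2) by (simp add: prod.reindex[OF inj])
    also have "\<dots> = \<phi> \<one>\<^bsub>P_group m\<^esub>"
      using hom_finprod_int_pow[OF P_group_comm_group[OF m] \<phi>P F(1) subset_trans[OF F(2) B_sub], of n]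
      by (simp add: one)
    also have "\<dots> = 1"
      using hom_one[OF \<phi>P P.is_group C.is_group] by (simp add: Cstar_def)
    finally show "n g = 0" using indep[OF K(1) j(1), of "\<lambda>k. n (c k)"] j(2) by simp
  qed (rule B_sub)
  moreover have "infinite B" using \<open>inj c\<close> by (simp add: B_def finite_image_iff)
  ultimately show ?thesis
    unfolding infinite_rank_def
    using countable_infinite_independent_attains_rank[OF countable_carrier_P_group[OF m]] by blast
qed

end
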